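(* Let $X$ be an amenable UDBG space and let $[X]_{\mathbb{R}}\in H^{\mathrm{uf}}_0(X;\mathbb{R})$ be its fundamental class. Then $\|[X]_{\mathbb{R}}\|_\infty=1$.
   Context: $\mathbb{N}=\{0,1,2,\dots\}$. A metric space $X$ is a UDBG space if (i) there is $\varepsilon>0$ such that for all $x,y\in X$: $d(x,y)<\varepsilon$ if and only if $x=y$; and (ii) for every $r>0$ there is $K>0$ with $|B_r(x)|<K$ for all $x\in X$. A UDBG space $X$ is amenable if there is a sequence $(S_n)_{n\in\mathbb{N}}$ of non-empty finite subsets of $X$ (a Følner sequence) such that $\lim_{n\to\infty}|\partial_r(S_n)|/|S_n|=0$ for every $r>0$, where $\partial_r(S)=\{x\in X\setminus S : d(x,S)\le r\}$ is the $r$-boundary of $S$. Uniformly finite homology: let $R=\mathbb{R}$ with the standard absolute value $|\cdot|$. For a UDBG space $X$ and $n\in\mathbb{N}$, $C^{\mathrm{uf}}_n(X;R)$ is the $R$-module of functions $X^{n+1}\to R$, written as formal sums $c=\sum_{x\in X^{n+1}}c_x\cdot x$, such that $\sup_x|c_x|<\infty$ and there is a constant $\rho>0$ (depending on $c$) with $c_x=0$ whenever $x=(x_0,\dots,x_n)$ satisfies $\sup_{i,j}d(x_i,x_j)>\rho$. The boundary operator $\partial_n\colon C^{\mathrm{uf}}_n(X;R)\to C^{\mathrm{uf}}_{n-1}(X;R)$ is the extension to such (possibly infinite) sums of $(x_0,\dots,x_n)\mapsto\sum_{j=0}^n(-1)^j(x_0,\dots,\widehat{x_j},\dots,x_n)$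 (and every $0$-chain is a cycle). $H^{\mathrm{uf}}_*(X;R)$ is the homology of this chain complex. The fundamental class $[X]_{\mathbb{R}}\in H^{\mathrm{uf}}_0(X;\mathbb{R})$ is the class represented by the cycle $\sum_{x\in X}1\cdot x$. The $\ell^\infty$-norm on chains is $\|\sum_x c_x\cdot x\|_\infty=\sup_x|c_x|$, and the $\ell^\infty$-semi-norm of $\alpha\in H^{\mathrm{uf}}_n(X;R)$ is $\|\alpha\|_\infty=\inf\{\|c\|_\infty : c\in C^{\mathrm{uf}}_n(X;R),\ \partial c=0,\ [c]=\alpha\}$. *)

theory Defs
  imports "HOL-Analysis.Analysis"
begin

definition delete_nth :: "nat \<Rightarrow> 'a list \<Rightarrow> 'a list" where
  "delete_nth j xs = take j xs @ drop (Suc j) xs"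

text \<open>The coefficient of \<open>ys\<close> in the boundary of the single \<open>n\<close>-simplex \<open>xs\<close>.\<close>
definition simplex_boundary :: "nat \<Rightarrow> 'a list \<Rightarrow> 'a list \<Rightarrow> real" where
  "simplex_boundary n xs ys = (\<Sum>j\<le>n. (-1) ^ j * (if delete_nth j xs = ys then 1 else 0))"

text \<open>
  Chains of degree \<open>n\<close> are functions on all lists that vanish off the
  \<open>(n+1)\<close>-tuples of points, so the supremum may be taken over all lists; this also makes
  the norm of the zero chain equal to 0 when there are no tuples at all.
\<close>
definition linf_norm :: "('a list \<Rightarrow> real) \<Rightarrow> real" where
  "linf_norm c = (SUP xs. \<bar>c xs\<bar>)"

locale UDBG_space = Metric_space +
  assumes uniformly_discrete: "\<exists>\<epsilon>>0. \<forall>x\<in>M. \<forall>y\<in>M. d x y < \<epsilon> \<longleftrightarrow> x = y"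
    and bounded_geometry:
      "\<And>r. r > 0 \<Longrightarrow> \<exists>K>0. \<forall>x\<in>M. finite (mball x r) \<and> real (card (mball x r)) < K"
begin

definition point_setdist :: "'a \<Rightarrow> 'a set \<Rightarrow> real" where
  "point_setdist x S = (INF s\<in>S. d x s)"

definition r_boundary :: "real \<Rightarrow> 'a set \<Rightarrow> 'a set" where
  "r_boundary r S = {x \<in> M - S. point_setdist x S \<le> r}"

definition Folner_sequence :: "(nat \<Rightarrow> 'a set) \<Rightarrow> bool" where
  "Folner_sequence S \<longleftrightarrow>
     (\<forall>n. S n \<noteq> {} \<and> finite (S n) \<and> S n \<subseteq> M) \<and>
     (\<forall>r>0. (\<lambda>n. real (card (r_boundary r (S n))) / real (card (S n))) \<longlonglongrightarrow> 0)"

definition amenable :: bool where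
  "amenable \<longleftrightarrow> (\<exists>S. Folner_sequence S)"

text \<open>The elements of \<open>M\<^sup>n\<^sup>+\<^sup>1\<close>.\<close>
definition simplices :: "nat \<Rightarrow> 'a list set" where
  "simplices n = {xs. length xs = Suc n \<and> set xs \<subseteq> M}"

definition simplex_diam :: "'a list \<Rightarrow> real" where
  "simplex_diam xs = Max ((\<lambda>(x, y). d x y) ` (set xs \<times> set xs))"

definition uf_chains :: "nat \<Rightarrow> ('a list \<Rightarrow> real) set" where
  "uf_chains n = {c.
     (\<forall>xs. xs \<notin> simplices n \<longrightarrow> c xs = 0) \<and>
     bdd_above (range (\<lambda>xs. \<bar>c xs\<bar>)) \<and>
     (\<exists>\<rho>>0. \<forall>xs\<in>simplices n. simplex_diam xs > \<rho> \<longrightarrow> c xs = 0)}"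

text \<open>
  On chains of positive degree, only finitely many terms of the infinite sum are non-zero
  (see \<open>uf_boundary_finite\<close> below). Degree 0 has to be treated separately: deleting the
  only entry of a 1-tuple gives the empty list, so the general formula would yield the
  augmentation instead of the zero map.
\<close>
definition uf_boundary :: "nat \<Rightarrow> ('a list \<Rightarrow> real) \<Rightarrow> 'a list \<Rightarrow> real" where
  "uf_boundary n c =
     (if n = 0 then (\<lambda>ys. 0)
      else (\<lambda>ys. infsum (\<lambda>xs. c xs * simplex_boundary n xs ys) (simplices n)))"

definition uf_cycles :: "nat \<Rightarrow> ('a list \<Rightarrow> real) set" where
  "uf_cycles n = {c \<in> uf_chains n. uf_boundary n c = (\<lambda>ys. 0)}"

definition uf_homologous :: "nat \<Rightarrow> (('a list \<Rightarrow> real) \<times> ('a list \<Rightarrow> real)) set" where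
  "uf_homologous n = {(c, c'). c \<in> uf_cycles n \<and> c' \<in> uf_cycles n \<and>
     (\<exists>b\<in>uf_chains (Suc n). (\<lambda>xs. c' xs - c xs) = uf_boundary (Suc n) b)}"

definition uf_homology :: "nat \<Rightarrow> ('a list \<Rightarrow> real) set set" where
  "uf_homology n = uf_cycles n // uf_homologous n"

definition uf_class :: "nat \<Rightarrow> ('a list \<Rightarrow> real) \<Rightarrow> ('a list \<Rightarrow> real) set" where
  "uf_class n c = uf_homologous n `` {c}"

definition uf_seminorm :: "nat \<Rightarrow> ('a list \<Rightarrow> real) set \<Rightarrow> real" where
  "uf_seminorm n \<alpha> = Inf {linf_norm c |c. c \<in> uf_cycles n \<and> uf_class n c = \<alpha>}"

definition fundamental_cycle :: "'a list \<Rightarrow> real" where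
  "fundamental_cycle xs = (if xs \<in> simplices 0 then 1 else 0)"

definition fundamental_class :: "('a list \<Rightarrow> real) set" where
  "fundamental_class = uf_class 0 fundamental_cycle"

lemma simplex_diam_ge: "x \<in> set xs \<Longrightarrow> y \<in> set xs \<Longrightarrow> d x y \<le> simplex_diam xs"
  unfolding simplex_diam_def by (rule Max_ge) force+

lemma uf_boundary_finite:
  assumes c: "c \<in> uf_chains n" and n: "n \<noteq> 0"
  shows "finite {xs \<in> simplices n. c xs * simplex_boundary n xs ys \<noteq> 0}"
proof -
  obtain \<rho> where \<rho>: "\<rho> > 0" "\<And>xs. xs \<in> simplices n \<Longrightarrow> simplex_diam xs > \<rho> \<Longrightarrow> c xs = 0"
    using c unfolding uf_chains_def by blast
  let ?y = "hd ys"
  have sub: "{xs \<in> simplices n. c xs * simplex_boundary n xs ys \<noteq> 0}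
      \<subseteq> (if ?y \<in> M then {xs. set xs \<subseteq> mball ?y (\<rho> + 1) \<and> length xs = Suc n} else {})"
  proof
    fix xs assume "xs \<in> {xs \<in> simplices n. c xs * simplex_boundary n xs ys \<noteq> 0}"
    then have xs: "xs \<in> simplices n" "c xs \<noteq> 0" "simplex_boundary n xs ys \<noteq> 0" by auto
    have "\<exists>j\<le>n. delete_nth j xs = ys"
    proof (rule ccontr)
      assume "\<not> ?thesis"
      then have "simplex_boundary n xs ys = 0"
        unfolding simplex_boundary_def by (intro sum.neutral) auto
      with xs show False by simp
    qed
    then obtain j where j: "j \<le> n" "delete_nth j xs = ys" by blast
    have len: "length xs = Suc n" "set xs \<subseteq> M" using xs by (auto simp: simplices_def)
    have "length ys = n" using j len by (auto simp: delete_nth_def)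
    then have "?y \<in> set ys" using n by (cases ys) auto
    also have "set ys \<subseteq> set xs"
      using j(2) by (auto simp: delete_nth_def dest: in_set_takeD in_set_dropD)
    finally have y: "?y \<in> set xs" .
    have "d ?y x \<le> \<rho>" if "x \<in> set xs" for x
      using simplex_diam_ge[OF y that] \<rho>(2)[OF xs(1)] xs(2) by fastforce
    then have "set xs \<subseteq> mball ?y (\<rho> + 1)" using len y by force
    then show "xs \<in> (if ?y \<in> M then {xs. set xs \<subseteq> mball ?y (\<rho> + 1) \<and> length xs = Suc n} else {})"
      using len y by auto
  qed
  have "finite (mball ?y (\<rho> + 1))" if "?y \<in> M"
    using bounded_geometry[of "\<rho> + 1"] \<rho>(1) that by auto
  then show ?thesis
    by (intro finite_subset[OF sub]) (auto intro: finite_lists_length_eq)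
qed

lemma uf_boundary_summable:
  assumes "c \<in> uf_chains n" and "n \<noteq> 0"
  shows "(\<lambda>xs. c xs * simplex_boundary n xs ys) summable_on simplices n"
proof -
  let ?f = "\<lambda>xs. c xs * simplex_boundary n xs ys"
  have "?f summable_on {xs \<in> simplices n. ?f xs \<noteq> 0}"
    using uf_boundary_finite[OF assms] by (rule summable_on_finite)
  then show ?thesis
    by (subst summable_on_cong_neutral[where T = "{xs \<in> simplices n. ?f xs \<noteq> 0}" and g = ?f]) auto
qed

lemma uf_chains_lincomb:
  assumes a: "a \<in> uf_chains n" and b: "b \<in> uf_chains n"
  shows "(\<lambda>xs. s * a xs + t * b xs) \<in> uf_chains n"
proof -
  obtain A where A: "\<And>xs. \<bar>a xs\<bar> \<le> A" using a by (auto simp: uf_chains_def bdd_above_def)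
  obtain B where B: "\<And>xs. \<bar>b xs\<bar> \<le> B" using b by (auto simp: uf_chains_def bdd_above_def)
  obtain \<rho> where \<rho>: "\<rho> > 0" "\<And>xs. xs \<in> simplices n \<Longrightarrow> simplex_diam xs > \<rho> \<Longrightarrow> a xs = 0"
    using a unfolding uf_chains_def by blast
  obtain \<sigma> where \<sigma>: "\<sigma> > 0" "\<And>xs. xs \<in> simplices n \<Longrightarrow> simplex_diam xs > \<sigma> \<Longrightarrow> b xs = 0"
    using b unfolding uf_chains_def by blast
  have "\<bar>s * a xs + t * b xs\<bar> \<le> \<bar>s\<bar> * A + \<bar>t\<bar> * B" for xs
  proof -
    have "\<bar>s * a xs + t * b xs\<bar> \<le> \<bar>s\<bar> * \<bar>a xs\<bar> + \<bar>t\<bar> * \<bar>b xs\<bar>"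
      by (metis abs_mult abs_triangle_ineq)
    also have "\<dots> \<le> \<bar>s\<bar> * A + \<bar>t\<bar> * B"
      by (intro add_mono mult_left_mono A B) auto
    finally show ?thesis .
  qed
  then have "bdd_above (range (\<lambda>xs. \<bar>s * a xs + t * b xs\<bar>))"
    by (intro bdd_aboveI2)
  moreover have "\<exists>\<tau>>0. \<forall>xs\<in>simplices n. simplex_diam xs > \<tau> \<longrightarrow> s * a xs + t * b xs = 0"
    using \<rho> \<sigma> by (intro exI[of _ "max \<rho> \<sigma>"]) auto
  ultimately show ?thesis using a b by (auto simp: uf_chains_def)
qed

lemma uf_boundary_lincomb:
  assumes a: "a \<in> uf_chains n" and b: "b \<in> uf_chains n"
  shows "uf_boundary n (\<lambda>xs. s * a xs + t * b xs) =
    (\<lambda>ys. s * uf_boundary n a ys + t * uf_boundary n b ys)"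
proof (cases "n = 0")
  case False
  show ?thesis
  proof
    fix ys
    note sa = uf_boundary_summable[OF a False, of ys]
    note sb = uf_boundary_summable[OF b False, of ys]
    have "infsum (\<lambda>xs. (s * a xs + t * b xs) * simplex_boundary n xs ys) (simplices n) =
      infsum (\<lambda>xs. s * (a xs * simplex_boundary n xs ys) + t * (b xs * simplex_boundary n xs ys))
        (simplices n)"
      by (simp add: algebra_simps)
    also have "\<dots> = s * infsum (\<lambda>xs. a xs * simplex_boundary n xs ys) (simplices n) +
        t * infsum (\<lambda>xs. b xs * simplex_boundary n xs ys) (simplices n)"
      by (subst infsum_add) (auto intro!: summable_on_cmult_right sa sb simp: infsum_cmult_right')
    finally show "uf_boundary n (\<lambda>xs. s * a xs + t * b xs) ys =
        s * uf_boundary n a ys + t * uf_boundary n b ys"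
      using False by (simp add: uf_boundary_def)
  qed
qed (simp add: uf_boundary_def)

lemma zero_uf_chain: "(\<lambda>xs. 0) \<in> uf_chains n"
  by (auto simp: uf_chains_def intro: exI[of _ 1])

lemma equiv_uf_homologous: "equiv (uf_cycles n) (uf_homologous n)"
proof (rule equivI)
  show "uf_homologous n \<subseteq> uf_cycles n \<times> uf_cycles n"
    by (auto simp: uf_homologous_def)
  have "uf_boundary (Suc n) (\<lambda>xs. 0) = (\<lambda>ys. 0)" by (simp add: uf_boundary_def)
  then show "refl_on (uf_cycles n) (uf_homologous n)"
    using zero_uf_chain[of "Suc n"] by (force simp: refl_on_def uf_homologous_def)
  show "sym (uf_homologous n)"
  proof (rule symI)
    fix c c' assume "(c, c') \<in> uf_homologous n"
    then obtain b where cc: "c \<in> uf_cycles n" "c' \<in> uf_cycles n"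
      and b: "b \<in> uf_chains (Suc n)" "(\<lambda>xs. c' xs - c xs) = uf_boundary (Suc n) b"
      by (auto simp: uf_homologous_def)
    have "(\<lambda>xs. c xs - c' xs) = uf_boundary (Suc n) (\<lambda>xs. (-1) * b xs + 0 * b xs)"
      unfolding uf_boundary_lincomb[OF b(1) b(1)] b(2)[symmetric] by auto
    then show "(c', c) \<in> uf_homologous n"
      using cc uf_chains_lincomb[OF b(1) b(1), of "-1" 0] unfolding uf_homologous_def by blast
  qed
  show "trans (uf_homologous n)"
  proof (rule transI)
    fix c c' c'' assume "(c, c') \<in> uf_homologous n" "(c', c'') \<in> uf_homologous n"
    then obtain b b' where cc: "c \<in> uf_cycles n" "c'' \<in> uf_cycles n"
      and b: "b \<in> uf_chains (Suc n)" "(\<lambda>xs. c' xs - c xs) = uf_boundary (Suc n) b"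
      and b': "b' \<in> uf_chains (Suc n)" "(\<lambda>xs. c'' xs - c' xs) = uf_boundary (Suc n) b'"
      by (auto simp: uf_homologous_def)
    have "(\<lambda>xs. c'' xs - c xs) = uf_boundary (Suc n) (\<lambda>xs. 1 * b xs + 1 * b' xs)"
      unfolding uf_boundary_lincomb[OF b(1) b'(1)] b(2)[symmetric] b'(2)[symmetric] by auto
    then show "(c, c'') \<in> uf_homologous n"
      using cc uf_chains_lincomb[OF b(1) b'(1), of 1 1] unfolding uf_homologous_def by blast
  qed
qed

lemma fundamental_cycle_in_uf_cycles: "fundamental_cycle \<in> uf_cycles 0"
proof -
  have diam: "simplex_diam xs \<le> 1" if xs: "xs \<in> simplices 0" for xs
  proof -
    obtain x where "xs = [x]" "x \<in> M"
      using xs by (auto simp: simplices_def length_Suc_conv)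
    then show ?thesis by (simp add: simplex_diam_def)
  qed
  have "bdd_above (range (\<lambda>xs. \<bar>fundamental_cycle xs\<bar>))"
    by (rule bdd_aboveI2[of _ _ 1]) (simp add: fundamental_cycle_def)
  moreover have "\<forall>xs\<in>simplices 0. simplex_diam xs > 1 \<longrightarrow> fundamental_cycle xs = 0"
    using diam by force
  ultimately have "fundamental_cycle \<in> uf_chains 0"
    unfolding uf_chains_def by (auto simp: fundamental_cycle_def intro: exI[of _ 1])
  then show ?thesis by (simp add: uf_cycles_def uf_boundary_def)
qed

lemma fundamental_class_in_uf_homology: "fundamental_class \<in> uf_homology 0"
  unfolding fundamental_class_def uf_class_def uf_homology_def
  by (rule quotientI[OF fundamental_cycle_in_uf_cycles])

end

end

theory Submission
  imports Defs
begin

text \<open>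
  The fundamental cycle has norm 1, so the only issue is that no homologous cycle \<open>c\<close> is smaller.
  The reason is conservation of mass: a \<open>1\<close>-chain \<open>b\<close> moves mass along its edges, and
  \<open>\<partial>b\<close> records the net gain at each point. Summed over a finite set \<open>S\<close>, the edges inside
  \<open>S\<close> cancel and only those that cross the boundary of \<open>S\<close> contribute. As the edges of \<open>b\<close>
  have length at most some \<open>\<rho>\<close> and bounded coefficients, bounded geometry bounds the total gain
  by \<open>C * |\<partial>\<^sub>\<rho> S|\<close> with \<open>C\<close> independent of \<open>S\<close>
  (\<open>sum_uf_boundary_le_card_r_boundary\<close>). Hence
  \<open>|S| = \<Sum>\<^sub>S 1 \<le> \<parallel>c\<parallel> * |S| + C * |\<partial>\<^sub>\<rho> S|\<close>; dividing by \<open>|S|\<close> and letting \<open>S\<close> run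
  through a Folner sequence yields \<open>1 \<le> \<parallel>c\<parallel>\<close>.
\<close>

context UDBG_space
begin

lemma r_boundaryI:
  assumes "y \<in> M - S" "x \<in> S" "d y x \<le> r"
  shows "y \<in> r_boundary r S"
proof -
  have "point_setdist y S \<le> d y x"
    unfolding point_setdist_def using assms(2) by (intro cINF_lower bdd_belowI2[of _ 0]) auto
  then show ?thesis using assms by (auto simp: r_boundary_def)
qed

text \<open>
  Without this, \<open>card\<close> of the boundary could be the default value 0 and the Folner condition
  would carry no information. Bounded geometry covers the boundary by finitely many finite balls.
\<close>
lemma finite_r_boundary:
  assumes S: "finite S" "S \<noteq> {}" "S \<subseteq> M" and r: "r > 0"
  shows "finite (r_boundary r S)"
proof (rule finite_subset)
  show "r_boundary r S \<subseteq> (\<Union>x\<in>S. mball x (r + 1))"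
  proof
    fix y assume y: "y \<in> r_boundary r S"
    have "Min (d y ` S) \<in> d y ` S" using S by (intro Min_in) auto
    then obtain x where x: "x \<in> S" "d y x = Min (d y ` S)" by auto
    have "d y x = point_setdist y S"
      using x S by (simp add: point_setdist_def cInf_eq_Min)
    with y x r S show "y \<in> (\<Union>x\<in>S. mball x (r + 1))"
      by (auto simp: r_boundary_def commute intro!: bexI[of _ x])
  qed
  show "finite (\<Union>x\<in>S. mball x (r + 1))"
    using bounded_geometry[of "r + 1"] r S by auto
qed

lemma simplex_boundary_edge:
  "simplex_boundary (Suc 0) [u, v] [x] = (if v = x then 1 else 0) - (if u = x then 1 else 0)"
  by (simp add: simplex_boundary_def delete_nth_def)

text \<open>
  One finite window \<open>T\<close> may serve for all points \<open>x\<close> of a set at once, which turns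
  the sum of \<open>\<partial>b\<close> over that set into a finite double sum.
\<close>
lemma uf_boundary_edges_eq:
  assumes T: "finite T" "T \<subseteq> M" and x: "x \<in> T"
    and near: "\<And>u. u \<in> M \<Longrightarrow> b [u, x] \<noteq> 0 \<or> b [x, u] \<noteq> 0 \<Longrightarrow> u \<in> T"
  shows "uf_boundary (Suc 0) b [x] = (\<Sum>y\<in>T. b [y, x] - b [x, y])"
proof -
  let ?f = "\<lambda>xs. b xs * simplex_boundary (Suc 0) xs [x]"
  let ?e = "\<lambda>(u, v). [u, v]"
  have "infsum ?f (simplices (Suc 0)) = infsum ?f (?e ` (T \<times> T))"
  proof (rule infsum_cong_neutral)
    fix xs assume xs: "xs \<in> simplices (Suc 0) - ?e ` (T \<times> T)"
    then obtain u v where uv: "xs = [u, v]" "u \<in> M" "v \<in> M" "\<not> (u \<in> T \<and> v \<in> T)"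
      by (fastforce simp: simplices_def length_Suc_conv)
    then show "?f xs = 0"
      using near[of u] near[of v] x by (auto simp: simplex_boundary_edge)
  next
    fix xs assume "xs \<in> ?e ` (T \<times> T) - simplices (Suc 0)"
    then show "?f xs = 0" using T by (auto simp: simplices_def)
  qed auto
  also have "\<dots> = (\<Sum>p\<in>T \<times> T. ?f (?e p))"
    using T by (subst infsum_finite) (auto simp: sum.reindex inj_on_def)
  also have "\<dots> = (\<Sum>u\<in>T. \<Sum>v\<in>T. ?f [u, v])"
    by (simp add: sum.cartesian_product case_prod_unfold)
  also have "\<dots> = (\<Sum>u\<in>T. \<Sum>v\<in>T. b [u, v] * (if v = x then 1 else 0))
      - (\<Sum>u\<in>T. \<Sum>v\<in>T. b [u, v] * (if u = x then 1 else 0))"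
    by (simp add: simplex_boundary_edge right_diff_distrib sum_subtractf)
  also have "(\<Sum>u\<in>T. \<Sum>v\<in>T. b [u, v] * (if u = x then 1 else 0)) =
      (\<Sum>v\<in>T. \<Sum>u\<in>T. b [u, v] * (if u = x then 1 else 0))"
    by (rule sum.swap)
  finally show ?thesis
    using T x by (simp add: uf_boundary_def sum_subtractf if_distrib cong: if_cong)
qed

text \<open>
  The discrete divergence theorem: the net flow into \<open>S\<close> passes through edges with one end in
  \<open>S\<close> and the other in \<open>\<partial>\<^sub>\<rho> S\<close>, and each point of \<open>\<partial>\<^sub>\<rho> S\<close> is an end of boundedly many of them.
\<close>
lemma sum_uf_boundary_le_card_r_boundary:
  assumes b: "b \<in> uf_chains (Suc 0)"
  obtains \<rho> C where "\<rho> > 0"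
    and "\<And>S. finite S \<Longrightarrow> S \<noteq> {} \<Longrightarrow> S \<subseteq> M \<Longrightarrow>
      \<bar>\<Sum>x\<in>S. uf_boundary (Suc 0) b [x]\<bar> \<le> C * real (card (r_boundary \<rho> S))"
proof -
  obtain B where B: "\<And>xs. \<bar>b xs\<bar> \<le> B"
    using b by (auto simp: uf_chains_def bdd_above_def)
  have "B \<ge> 0" using B[of "[]"] by linarith
  obtain \<rho> where \<rho>: "\<rho> > 0" "\<And>xs. xs \<in> simplices (Suc 0) \<Longrightarrow> simplex_diam xs > \<rho> \<Longrightarrow> b xs = 0"
    using b unfolding uf_chains_def by blast
  have far: "b [u, v] = 0" if "u \<in> M" "v \<in> M" "d u v > \<rho>" for u v
    using \<rho>(2)[of "[u, v]"] simplex_diam_ge[of u "[u, v]" v] that by (auto simp: simplices_def)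
  \<comment> \<open>The balls are open, so radius \<open>\<rho> + 1\<close> is used to capture points at distance exactly \<open>\<rho>\<close>.\<close>
  obtain K where K: "\<And>x. x \<in> M \<Longrightarrow> finite (mball x (\<rho> + 1)) \<and> real (card (mball x (\<rho> + 1))) < K"
    using bounded_geometry[of "\<rho> + 1"] \<rho>(1) by auto
  have "\<bar>\<Sum>x\<in>S. uf_boundary (Suc 0) b [x]\<bar> \<le> (K * (2 * B)) * real (card (r_boundary \<rho> S))"
    if S: "finite S" "S \<noteq> {}" "S \<subseteq> M" for S
  proof -
    let ?D = "r_boundary \<rho> S"
    define g where "g x y = b [y, x] - b [x, y]" for x y
    have D: "finite ?D" "?D \<subseteq> M" "S \<inter> ?D = {}"
      using finite_r_boundary[OF S \<rho>(1)] by (auto simp: r_boundary_def)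
    have near: "u \<in> S \<union> ?D" if "x \<in> S" "u \<in> M" "b [u, x] \<noteq> 0 \<or> b [x, u] \<noteq> 0" for x u
    proof -
      have "d u x \<le> \<rho>" using that S far[of u x] far[of x u] by (auto simp: commute not_less[symmetric])
      then show ?thesis using r_boundaryI[of u S x \<rho>] that by auto
    qed
    have "(\<Sum>x\<in>S. uf_boundary (Suc 0) b [x]) = (\<Sum>x\<in>S. \<Sum>y\<in>S \<union> ?D. g x y)"
      unfolding g_def using S D near by (intro sum.cong refl uf_boundary_edges_eq) auto
    also have "\<dots> = (\<Sum>x\<in>S. \<Sum>y\<in>S. g x y) + (\<Sum>x\<in>S. \<Sum>y\<in>?D. g x y)"
      using S D by (simp add: sum.union_disjoint sum.distrib)
    also have "(\<Sum>x\<in>S. \<Sum>y\<in>S. g x y) = 0"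
      unfolding g_def sum_subtractf using sum.swap[of "\<lambda>x y. b [y, x]" S S] by simp
    also have "(\<Sum>x\<in>S. \<Sum>y\<in>?D. g x y) = (\<Sum>y\<in>?D. \<Sum>x\<in>S. g x y)"
      by (rule sum.swap)
    finally have "\<bar>\<Sum>x\<in>S. uf_boundary (Suc 0) b [x]\<bar> \<le> (\<Sum>y\<in>?D. \<bar>\<Sum>x\<in>S. g x y\<bar>)"
      by (simp add: sum_abs)
    also have "\<dots> \<le> (\<Sum>y\<in>?D. K * (2 * B))"
    proof (rule sum_mono)
      fix y assume y: "y \<in> ?D"
      then have yM: "y \<in> M" using D by auto
      have "(\<Sum>x\<in>S. g x y) = (\<Sum>x\<in>S \<inter> mball y (\<rho> + 1). g x y)"
        using S yM far \<rho>(1) by (intro sum.mono_neutral_right) (auto simp: g_def commute)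
      also have "\<bar>\<dots>\<bar> \<le> (\<Sum>x\<in>S \<inter> mball y (\<rho> + 1). \<bar>g x y\<bar>)"
        by (rule sum_abs)
      also have "\<dots> \<le> real (card (S \<inter> mball y (\<rho> + 1))) * (2 * B)"
      proof (rule sum_bounded_above)
        show "\<bar>g x y\<bar> \<le> 2 * B" for x
          using B[of "[x, y]"] B[of "[y, x]"] by (simp add: g_def)
      qed
      also have "\<dots> \<le> K * (2 * B)"
      proof (rule mult_right_mono)
        have "card (S \<inter> mball y (\<rho> + 1)) \<le> card (mball y (\<rho> + 1))"
          using K[OF yM] by (intro card_mono) auto
        then show "real (card (S \<inter> mball y (\<rho> + 1))) \<le> K" using K[OF yM] by simp
      qed (use \<open>B \<ge> 0\<close> in simp)
      finally show "\<bar>\<Sum>x\<in>S. g x y\<bar> \<le> K * (2 * B)" .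
    qed
    also have "\<dots> = (K * (2 * B)) * real (card ?D)" by simp
    finally show ?thesis .
  qed
  with \<rho>(1) show ?thesis by (rule that)
qed

lemma abs_le_linf_norm:
  assumes "c \<in> uf_chains n"
  shows "\<bar>c xs\<bar> \<le> linf_norm c"
  using assms unfolding linf_norm_def by (intro cSUP_upper) (auto simp: uf_chains_def)

lemma linf_norm_fundamental_cycle:
  assumes "M \<noteq> {}"
  shows "linf_norm fundamental_cycle = 1"
  unfolding linf_norm_def
proof (rule cSup_eq_maximum)
  obtain x where "x \<in> M" using assms by blast
  then have "\<bar>fundamental_cycle [x]\<bar> = 1" by (simp add: fundamental_cycle_def simplices_def)
  then show "1 \<in> range (\<lambda>xs. \<bar>fundamental_cycle xs\<bar>)" by (metis rangeI)
qed (auto simp: fundamental_cycle_def)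

lemma linf_norm_ge_1_if_homologous_fundamental_cycle:
  assumes "amenable" and hom: "(c, fundamental_cycle) \<in> uf_homologous 0"
  shows "1 \<le> linf_norm c"
proof -
  obtain S where F: "Folner_sequence S" using assms(1) by (auto simp: amenable_def)
  then have S: "finite (S n)" "S n \<noteq> {}" "S n \<subseteq> M" for n by (auto simp: Folner_sequence_def)
  obtain b where c: "c \<in> uf_chains 0" and b: "b \<in> uf_chains (Suc 0)"
    and eq: "(\<lambda>xs. fundamental_cycle xs - c xs) = uf_boundary (Suc 0) b"
    using hom by (auto simp: uf_homologous_def uf_cycles_def)
  obtain \<rho> C where \<rho>: "\<rho> > 0"
    and C: "\<And>S. finite S \<Longrightarrow> S \<noteq> {} \<Longrightarrow> S \<subseteq> M \<Longrightarrow>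
      \<bar>\<Sum>x\<in>S. uf_boundary (Suc 0) b [x]\<bar> \<le> C * real (card (r_boundary \<rho> S))"
    using sum_uf_boundary_le_card_r_boundary[OF b] by blast
  let ?q = "\<lambda>n. real (card (r_boundary \<rho> (S n))) / real (card (S n))"
  have "1 \<le> linf_norm c + C * ?q n" for n
  proof -
    have pos: "real (card (S n)) > 0" using S[of n] by (simp add: card_gt_0_iff)
    have "real (card (S n)) = (\<Sum>x\<in>S n. c [x] + uf_boundary (Suc 0) b [x])"
      using S(3)[of n]
      by (simp add: eq[symmetric] fundamental_cycle_def simplices_def subset_iff)
    also have "\<dots> = (\<Sum>x\<in>S n. c [x]) + (\<Sum>x\<in>S n. uf_boundary (Suc 0) b [x])"
      by (rule sum.distrib)
    also have "(\<Sum>x\<in>S n. c [x]) \<le> real (card (S n)) * linf_norm c"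
      using abs_le_linf_norm[OF c] by (intro sum_bounded_above) (meson abs_le_D1)
    also have "(\<Sum>x\<in>S n. uf_boundary (Suc 0) b [x]) \<le> C * real (card (r_boundary \<rho> (S n)))"
      using C[OF S] by (meson abs_le_D1)
    finally show ?thesis using pos by (simp add: field_simps)
  qed
  moreover have "(\<lambda>n. linf_norm c + C * ?q n) \<longlonglongrightarrow> linf_norm c + C * 0"
    using F \<rho> by (intro tendsto_intros) (auto simp: Folner_sequence_def)
  ultimately show ?thesis by (intro LIMSEQ_le_const[of _ "linf_norm c"]) auto
qed

end

theorem proposition3p6:
  fixes M :: "'a set" and d :: "'a \<Rightarrow> 'a \<Rightarrow> real"
  assumes "UDBG_space M d"
    and "UDBG_space.amenable M d"
  shows "UDBG_space.uf_seminorm M d 0 (UDBG_space.fundamental_class M d) = 1"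
proof -
  interpret UDBG_space M d by fact
  have am: "amenable" by fact
  then have "M \<noteq> {}" by (auto simp: amenable_def Folner_sequence_def)
  show ?thesis
    unfolding uf_seminorm_def
  proof (rule cInf_eq_minimum)
    show "1 \<in> {linf_norm c |c. c \<in> uf_cycles 0 \<and> uf_class 0 c = fundamental_class}"
      using fundamental_cycle_in_uf_cycles linf_norm_fundamental_cycle[OF \<open>M \<noteq> {}\<close>]
      by (force simp: fundamental_class_def)
  next
    fix z assume "z \<in> {linf_norm c |c. c \<in> uf_cycles 0 \<and> uf_class 0 c = fundamental_class}"
    then obtain c where c: "z = linf_norm c" "c \<in> uf_cycles 0" "uf_class 0 c = fundamental_class"
      by blast
    then have "(c, fundamental_cycle) \<in> uf_homologous 0"
      using eq_equiv_class[OF _ equiv_uf_homologous fundamental_cycle_in_uf_cycles]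
      by (simp add: uf_class_def fundamental_class_def)
    then show "1 \<le> z"
      using linf_norm_ge_1_if_homologous_fundamental_cycle[OF am] c(1) by simp
  qed
qed

end
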